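(* Let $\Omega=(-1,1)\times(-1,1)$, $T>0$, $\mathscr{D}=\Omega\times(0,T)$, and $\rho_0(x)=+1$ for $x_2>0$, $\rho_0(x)=-1$ for $x_2<0$. Let $(\overline\rho,\overline v,\overline m)$ be an admissible subsolution for the initial condition $\rho_0$ (as defined in the context) such that $\overline\rho=\overline\rho(x_2,t)$, i.e. $\overline\rho$ does not depend on $x_1$. Then its mixing zone $\mathscr{U}$ is contained in $\{(x,t):\ |x_2|<2t\}$.
   Context: Notation: $x=(x_1,x_2)$, $\nabla^\perp=(-\partial_2,\partial_1)$, and $(0,s)$ denotes the vector in $\mathbb{R}^2$ with components $0$ and $s$. Admissible subsolution: a triple $(\rho,v,m)\in L^\infty(\mathscr{D};\mathbb{R}\times\mathbb{R}^2\times\mathbb{R}^2)$ such that (i) for all $\phi\in C_c^\infty(\overline\Omega\times[0,T))$: $\int_0^T\!\int_\Omega(\rho\,\partial_t\phi+m\cdot\nabla\phi)\,dx\,dt+\int_\Omega\phi(x,0)\rho_0(x)\,dx=0$; (ii) for a.e. $t\in(0,T)$: $\int_\Omega v\cdot\nabla\psi\,dx=0$ for all $\psi\in C^\infty(\overline\Omega)$; (iii) for a.e. $t\in(0,T)$: $\int_\Omega(v+(0,\rho))\cdot\nabla^\perp\psi\,dx=0$ for all $\psi\in C_c^\infty(\Omega)$; (iv) $|m-\rho v+\tfrac12(0,1-\rho^2)|\le\tfrac12(1-\rho^2)$ a.e. in $\mathscr{D}$; and there exists an open subset $\mathscr{U}\subset\mathscr{D}$ (called the mixing zone) such that (v) $|\rho|=1$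 a.e. in $\mathscr{D}\setminus\mathscr{U}$; (vi) $(\rho,v,m)$ is continuous in $\mathscr{U}$; (vii) $|m-\rho v+\tfrac12(0,1-\rho^2)|<\tfrac12(1-\rho^2)$ in $\mathscr{U}$. *)

theory Defs
  imports "HOL-Analysis.Analysis"
begin

(* Class C^k on an open set U, via iterated directional derivatives. *)
primrec Ck_on :: "nat \<Rightarrow> 'a::real_normed_vector set \<Rightarrow> ('a \<Rightarrow> real) \<Rightarrow> bool" where
  "Ck_on 0 U f \<longleftrightarrow> continuous_on U f"
| "Ck_on (Suc k) U f \<longleftrightarrow>
     (\<forall>x\<in>U. f differentiable (at x)) \<and>
     (\<forall>w. Ck_on k U (\<lambda>x. frechet_derivative f (at x) w))"

(* C^\<infinity>(S) for arbitrary S: restrictions to S of functions that are smooth on an open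
   neighbourhood of S.  For open S this is the usual space. *)
definition Cinf_on :: "'a::real_normed_vector set \<Rightarrow> ('a \<Rightarrow> real) \<Rightarrow> bool" where
  "Cinf_on S f \<longleftrightarrow>
     (\<exists>U g. open U \<and> S \<subseteq> U \<and> (\<forall>k. Ck_on k U g) \<and> (\<forall>x\<in>S. f x = g x))"

(* The support is a compact subset of S itself: for S = closure \<Omega> \<times> {0..<T} a function
   need not vanish at t = 0 or on the boundary of \<Omega>, but it vanishes for t near T. *)
definition Cinf_c_on :: "'a::real_normed_vector set \<Rightarrow> ('a \<Rightarrow> real) \<Rightarrow> bool" where
  "Cinf_c_on S f \<longleftrightarrow>
     Cinf_on S f \<and> (\<exists>K. compact K \<and> K \<subseteq> S \<and> (\<forall>x\<in>S - K. f x = 0))"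

definition Linf_on :: "'a::euclidean_space set \<Rightarrow> ('a \<Rightarrow> 'b::euclidean_space) \<Rightarrow> bool" where
  "Linf_on S f \<longleftrightarrow>
     f \<in> borel_measurable (lebesgue_on S) \<and> (\<exists>C. AE z in lebesgue_on S. norm (f z) \<le> C)"

definition grad :: "(real^2 \<Rightarrow> real) \<Rightarrow> real^2 \<Rightarrow> real^2" where
  "grad f x = (\<chi> i. frechet_derivative f (at x) (axis i 1))"

definition perp_grad :: "(real^2 \<Rightarrow> real) \<Rightarrow> real^2 \<Rightarrow> real^2" where
  "perp_grad f x = vector [- (grad f x $ 2), grad f x $ 1]"

definition weak_continuity_eq ::
  "(real^2) set \<Rightarrow> real \<Rightarrow> (real^2 \<Rightarrow> real) \<Rightarrow>
   ((real^2) \<times> real \<Rightarrow> real) \<Rightarrow> ((real^2) \<times> real \<Rightarrow> real^2) \<Rightarrow> bool" where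
  "weak_continuity_eq \<Omega> T \<rho>0 \<rho> m \<longleftrightarrow>
     (\<forall>\<phi>. Cinf_c_on (closure \<Omega> \<times> {0..<T}) \<phi> \<longrightarrow>
        (LINT t|lebesgue_on {0<..<T}. LINT x|lebesgue_on \<Omega>.
            \<rho> (x, t) * deriv (\<lambda>s. \<phi> (x, s)) t + m (x, t) \<bullet> grad (\<lambda>y. \<phi> (y, t)) x)
        + (LINT x|lebesgue_on \<Omega>. \<phi> (x, 0) * \<rho>0 x) = 0)"

(* Testing against all of C^\<infinity>(closure \<Omega>) encodes div v = 0 and zero normal component
   of v on the boundary of \<Omega>. *)
definition weak_div_free ::
  "(real^2) set \<Rightarrow> real \<Rightarrow> ((real^2) \<times> real \<Rightarrow> real^2) \<Rightarrow> bool" where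
  "weak_div_free \<Omega> T v \<longleftrightarrow>
     (AE t in lebesgue_on {0<..<T}. \<forall>\<psi>. Cinf_on (closure \<Omega>) \<psi> \<longrightarrow>
        (LINT x|lebesgue_on \<Omega>. v (x, t) \<bullet> grad \<psi> x) = 0)"

definition weak_Darcy_law ::
  "(real^2) set \<Rightarrow> real \<Rightarrow> ((real^2) \<times> real \<Rightarrow> real) \<Rightarrow> ((real^2) \<times> real \<Rightarrow> real^2) \<Rightarrow> bool" where
  "weak_Darcy_law \<Omega> T \<rho> v \<longleftrightarrow>
     (AE t in lebesgue_on {0<..<T}. \<forall>\<psi>. Cinf_c_on \<Omega> \<psi> \<longrightarrow>
        (LINT x|lebesgue_on \<Omega>. (v (x, t) + vector [0, \<rho> (x, t)]) \<bullet> perp_grad \<psi> x) = 0)"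

definition hull_defect :: "real \<Rightarrow> real^2 \<Rightarrow> real^2 \<Rightarrow> real" where
  "hull_defect r v m = norm (m - r *\<^sub>R v + (1/2) *\<^sub>R vector [0, 1 - r\<^sup>2])"

(* An element of L^\<infinity> is given by a function, here the representative that is continuous
   on \<U>; the strict inequality is then pointwise on \<U>. *)
definition is_mixing_zone ::
  "(real^2) set \<Rightarrow> real \<Rightarrow> ((real^2) \<times> real \<Rightarrow> real) \<Rightarrow> ((real^2) \<times> real \<Rightarrow> real^2) \<Rightarrow>
   ((real^2) \<times> real \<Rightarrow> real^2) \<Rightarrow> ((real^2) \<times> real) set \<Rightarrow> bool" where
  "is_mixing_zone \<Omega> T \<rho> v m \<U> \<longleftrightarrow>
     open \<U> \<and> \<U> \<subseteq> \<Omega> \<times> {0<..<T} \<and>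
     (AE z in lebesgue_on (\<Omega> \<times> {0<..<T} - \<U>). \<bar>\<rho> z\<bar> = 1) \<and>
     continuous_on \<U> (\<lambda>z. (\<rho> z, v z, m z)) \<and>
     (\<forall>z\<in>\<U>. hull_defect (\<rho> z) (v z) (m z) < (1/2) * (1 - (\<rho> z)\<^sup>2))"

definition admissible_subsolution ::
  "(real^2) set \<Rightarrow> real \<Rightarrow> (real^2 \<Rightarrow> real) \<Rightarrow>
   ((real^2) \<times> real \<Rightarrow> real) \<Rightarrow> ((real^2) \<times> real \<Rightarrow> real^2) \<Rightarrow> ((real^2) \<times> real \<Rightarrow> real^2) \<Rightarrow> bool" where
  "admissible_subsolution \<Omega> T \<rho>0 \<rho> v m \<longleftrightarrow>
     Linf_on (\<Omega> \<times> {0<..<T}) (\<lambda>z. (\<rho> z, v z, m z)) \<and>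
     weak_continuity_eq \<Omega> T \<rho>0 \<rho> m \<and>
     weak_div_free \<Omega> T v \<and>
     weak_Darcy_law \<Omega> T \<rho> v \<and>
     (AE z in lebesgue_on (\<Omega> \<times> {0<..<T}).
        hull_defect (\<rho> z) (v z) (m z) \<le> (1/2) * (1 - (\<rho> z)\<^sup>2)) \<and>
     (\<exists>\<U>. is_mixing_zone \<Omega> T \<rho> v m \<U>)"

end

theory Submission
  imports Defs "HOL-Real_Asymp.Real_Asymp"
begin

text \<open>
  The claim is a finite speed of propagation: a region in one of the two pure states \<open>\<rho> = 1\<close> and
  \<open>\<rho> = -1\<close> is invaded by the mixing zone at speed at most 2.

  Let \<open>\<sigma>\<close> be one of the values \<open>1\<close> and \<open>-1\<close>, and put \<open>u = 1 - \<sigma> \<rho>\<close>, the nonnegative deviation of the density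
  from the state \<open>\<sigma>\<close> (the hull condition forces \<open>\<bar>\<rho>\<bar> \<le> 1\<close>). Three observations give the bound.

  First, the velocity has zero vertical flux. Testing \<open>div v = 0\<close> with functions of \<open>x\<^sub>2\<close> alone shows
  that the mean of \<open>v\<^sub>2\<close> over almost every horizontal line is zero. As \<open>\<rho>\<close> is constant on horizontal lines, the
  product \<open>\<rho> v\<^sub>2\<close> has zero mean there too. This is the only place where the independence of \<open>x\<^sub>1\<close> is used.
  It is lemma \<open>no_vertical_flux\<close>; it passes from smooth test functions of \<open>x\<^sub>2\<close> to all Borel functions of
  \<open>x\<^sub>2\<close>, which is what multiplication by \<open>\<rho>\<close> demands.

  Second, by the hull condition the remaining vertical flux satisfies \<open>m\<^sub>2 - \<rho> v\<^sub>2 \<ge> - (1 - \<rho>\<^sup>2) = - u (2 - u)\<close>. Averaged over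
  \<open>x\<^sub>1\<close>, the continuity equation therefore is a scalar conservation law whose flux is controlled by \<open>u\<close>.
  Formally, for \<open>\<sigma> = 1\<close>,
  \<open>d/dt \<integral> u H(x\<^sub>2 - 2 t) dx = \<integral> (- 2 u - m\<^sub>2) H'(x\<^sub>2 - 2 t) dx \<le> - \<integral> u\<^sup>2 H'(x\<^sub>2 - 2 t) dx \<le> 0\<close>
  for every nondecreasing profile \<open>H\<close>. This is lemma \<open>slice_dissipation\<close>.

  Third, if \<open>H\<close> vanishes on the negative axis, then the integral is zero at time zero, hence at all times.
  So \<open>\<rho> = \<sigma>\<close> almost everywhere in \<open>{(x, t). \<sigma> x\<^sub>2 > 2 t}\<close>, which is lemma
  \<open>subsolution_constant_outside_cone\<close>. In the weak formulation, the formal derivative in time is replaced by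
  the test function \<open>exp (- 1 / (\<tau> - t)) exp (- 1 / (\<sigma> x\<^sub>2 - 2 t))\<close>, each factor being zero where its
  argument is not positive; the first factor is a cut-off in time with a derivative of the right sign.

  Finally, \<open>\<bar>\<rho>\<bar> < 1\<close> at every point of the mixing zone by the strict hull inequality. A point of the
  mixing zone outside the open cone would produce an open set of such points where \<open>\<rho> = \<sigma>\<close> almost
  everywhere.
\<close>

section \<open>Smooth functions on the whole space\<close>

text \<open>On the whole space the recursion of \<^const>\<open>Ck_on\<close> may be run through any known derivative, since
  Frechet derivatives are unique and no domain has to be carried along.\<close>

lemma Ck_on_SucI:
  assumes "\<And>x. (f has_derivative D x) (at x)"
    and "\<And>w. Ck_on k UNIV (\<lambda>x. D x w)"
  shows "Ck_on (Suc k) UNIV f"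
proof -
  have "frechet_derivative f (at x) = D x" for x
    using frechet_derivative_at[OF assms(1)] by simp
  then show ?thesis
    using assms by (auto simp: differentiable_def)
qed

lemma Ck_on_SucE:
  assumes "Ck_on (Suc k) UNIV f"
  obtains D where "\<And>x. (f has_derivative D x) (at x)" "\<And>w. Ck_on k UNIV (\<lambda>x. D x w)"
proof
  show "(f has_derivative frechet_derivative f (at x)) (at x)" for x
    using assms by (simp add: frechet_derivative_works)
  show "Ck_on k UNIV (\<lambda>x. frechet_derivative f (at x) w)" for w
    using assms by simp
qed

lemma Ck_on_Suc_imp: "Ck_on (Suc k) UNIV f \<Longrightarrow> Ck_on k UNIV f"
proof (induction k arbitrary: f)
  case 0
  then show ?case
    by (auto intro!: differentiable_imp_continuous_on simp: differentiable_on_def)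
next
  case (Suc k)
  obtain D where D: "\<And>x. (f has_derivative D x) (at x)"
    and CD: "\<And>w. Ck_on (Suc k) UNIV (\<lambda>x. D x w)"
    using Ck_on_SucE[OF Suc.prems] by blast
  show ?case
    using Ck_on_SucI[OF D Suc.IH[OF CD]] .
qed

lemma Ck_on_const: "Ck_on k UNIV (\<lambda>x. c)"
proof (induction k arbitrary: c)
  case (Suc k)
  show ?case
    by (rule Ck_on_SucI[where D = "\<lambda>_ _. 0"]) (use Suc in auto)
qed simp

lemma Ck_on_add: "Ck_on k UNIV f \<Longrightarrow> Ck_on k UNIV g \<Longrightarrow> Ck_on k UNIV (\<lambda>x. f x + g x)"
proof (induction k arbitrary: f g)
  case 0
  then show ?case by (auto intro: continuous_on_add)
next
  case (Suc k)
  obtain D where D: "\<And>x. (f has_derivative D x) (at x)" "\<And>w. Ck_on k UNIV (\<lambda>x. D x w)"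
    using Ck_on_SucE[OF Suc.prems(1)] by blast
  obtain E where E: "\<And>x. (g has_derivative E x) (at x)" "\<And>w. Ck_on k UNIV (\<lambda>x. E x w)"
    using Ck_on_SucE[OF Suc.prems(2)] by blast
  show ?case
    by (rule Ck_on_SucI[OF has_derivative_add[OF D(1) E(1)]]) (intro Suc.IH D E)
qed

lemma Ck_on_mult: "Ck_on k UNIV f \<Longrightarrow> Ck_on k UNIV g \<Longrightarrow> Ck_on k UNIV (\<lambda>x. f x * g x)"
proof (induction k arbitrary: f g)
  case 0
  then show ?case by (auto intro: continuous_on_mult)
next
  case (Suc k)
  obtain D where D: "\<And>x. (f has_derivative D x) (at x)" "\<And>w. Ck_on k UNIV (\<lambda>x. D x w)"
    using Ck_on_SucE[OF Suc.prems(1)] by blast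
  obtain E where E: "\<And>x. (g has_derivative E x) (at x)" "\<And>w. Ck_on k UNIV (\<lambda>x. E x w)"
    using Ck_on_SucE[OF Suc.prems(2)] by blast
  show ?case
    by (rule Ck_on_SucI[OF has_derivative_mult[OF D(1) E(1)]])
      (intro Ck_on_add Suc.IH D E Suc.prems[THEN Ck_on_Suc_imp])
qed

text \<open>The rule for functions of a single real variable: there the directional derivatives are the
  multiples of one function, so that a family of functions closed under differentiation is smooth
  by induction on the order.\<close>

lemma Ck_on_real_SucI:
  fixes h :: "real \<Rightarrow> real"
  assumes "\<And>x. (h has_real_derivative h' x) (at x)" and "Ck_on k UNIV h'"
  shows "Ck_on (Suc k) UNIV h"
  by (rule Ck_on_SucI[OF assms(1)[unfolded has_field_derivative_def]])
    (intro Ck_on_mult Ck_on_const assms)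

lemma Ck_on_compose_affine:
  fixes h :: "real \<Rightarrow> real" and l :: "'a::real_normed_vector \<Rightarrow> real"
  assumes l: "bounded_linear l"
  shows "Ck_on k UNIV h \<Longrightarrow> Ck_on k UNIV (\<lambda>z. h (l z + c))"
proof (induction k arbitrary: h)
  case 0
  have "continuous_on UNIV (\<lambda>z. l z + c)"
    by (intro continuous_intros linear_continuous_on l)
  with 0 show ?case
    using continuous_on_compose2[of UNIV h UNIV "\<lambda>z. l z + c"] by simp
next
  case (Suc k)
  obtain D where D: "\<And>x. (h has_derivative D x) (at x)" "\<And>w. Ck_on k UNIV (\<lambda>x. D x w)"
    using Ck_on_SucE[OF Suc.prems] by blast
  have aff: "((\<lambda>z. l z + c) has_derivative l) (at z)" for z
    using has_derivative_add_const[OF bounded_linear_imp_has_derivative[OF l]] .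
  show ?case
    by (rule Ck_on_SucI[OF has_derivative_compose[OF aff D(1)]]) (intro Suc.IH D)
qed

lemma Cinf_onI: "(\<And>k. Ck_on k UNIV f) \<Longrightarrow> Cinf_on S f"
  unfolding Cinf_on_def by (intro exI[of _ UNIV] exI[of _ f]) simp

section \<open>A smooth function supported on a half-line\<close>

text \<open>The case \<open>n = 0\<close> is the standard function \<open>exp (- 1 / s)\<close> that is flat at the origin. The
  extra factor \<open>(1 / s) ^ n\<close> makes the family closed under differentiation up to linear
  combinations.\<close>

definition flat_exp :: "nat \<Rightarrow> real \<Rightarrow> real" where
  "flat_exp n s = (if s > 0 then (1 / s) ^ n * exp (- (1 / s)) else 0)"

lemma flat_exp_nonneg: "flat_exp n s \<ge> 0"
  by (simp add: flat_exp_def)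

lemma flat_exp_eq_0_iff: "flat_exp n s = 0 \<longleftrightarrow> s \<le> 0"
  by (auto simp: flat_exp_def)

lemma flat_exp_has_derivative:
  "(flat_exp n has_real_derivative flat_exp (n + 2) s - real n * flat_exp (n + 1) s) (at s)"
proof -
  consider "s > 0" | "s < 0" | "s = 0" by linarith
  then show ?thesis
  proof cases
    case 1
    have inv: "((\<lambda>s. 1 / s) has_real_derivative - ((1 / s) ^ 2)) (at s)"
      using 1 by (auto intro!: derivative_eq_intros simp: power2_eq_square)
    have "real n * (1 / s) ^ (n - 1) * (1 / s) ^ 2 = real n * (1 / s) ^ (n + 1)"
      by (cases n) (simp_all add: power2_eq_square)
    then have "((\<lambda>s. (1 / s) ^ n * exp (- (1 / s))) has_real_derivative
        flat_exp (n + 2) s - real n * flat_exp (n + 1) s) (at s)"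
      using DERIV_mult[OF DERIV_power[OF inv, of n] DERIV_chain2[OF DERIV_exp DERIV_minus[OF inv]]] 1
      by (simp add: flat_exp_def algebra_simps power_add power2_eq_square)
    then show ?thesis
      by (rule has_field_derivative_transform_within_open[where S = "{0<..}"])
        (use 1 in \<open>auto simp: flat_exp_def\<close>)
  next
    case 2
    have "((\<lambda>s. 0) has_real_derivative flat_exp (n + 2) s - real n * flat_exp (n + 1) s) (at s)"
      using 2 by (simp add: flat_exp_def)
    then show ?thesis
      by (rule has_field_derivative_transform_within_open[where S = "{..<0}"])
        (use 2 in \<open>auto simp: flat_exp_def\<close>)
  next
    case 3
    \<comment> \<open>At the origin the difference quotient is the next member of the family, which the exponential
       drives to zero from the right; from the left it vanishes identically.\<close>
    have r: "((\<lambda>s. flat_exp n s / s) \<longlongrightarrow> 0) (at_right 0)"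
    proof (rule Lim_transform_eventually)
      show "((\<lambda>s::real. (1 / s) ^ Suc n * exp (- (1 / s))) \<longlongrightarrow> 0) (at_right 0)"
        by real_asymp
      show "\<forall>\<^sub>F s in at_right 0. (1 / s) ^ Suc n * exp (- (1 / s)) = flat_exp n s / s"
        unfolding eventually_at_right_field
        by (intro exI[of _ 1]) (auto simp: flat_exp_def)
    qed
    have l: "((\<lambda>s. flat_exp n s / s) \<longlongrightarrow> 0) (at_left 0)"
    proof (rule Lim_transform_eventually)
      show "\<forall>\<^sub>F s in at_left 0. 0 = flat_exp n s / s"
        unfolding eventually_at_left_field
        by (intro exI[of _ "-1"]) (auto simp: flat_exp_def)
    qed simp
    show ?thesis
      using filterlim_split_at[OF l r] 3
      by (simp add: has_field_derivative_iff flat_exp_def)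
  qed
qed

lemma flat_exp_smooth: "Ck_on k UNIV (flat_exp n)"
proof (induction k arbitrary: n)
  case 0
  show ?case
    by (auto intro!: DERIV_continuous_on flat_exp_has_derivative)
next
  case (Suc k)
  have "Ck_on k UNIV (\<lambda>s. flat_exp (n + 2) s + (- real n) * flat_exp (n + 1) s)"
    by (intro Ck_on_add Ck_on_mult Ck_on_const Suc.IH)
  then show ?case
    by (intro Ck_on_real_SucI[OF flat_exp_has_derivative]) simp
qed

text \<open>With \<open>y = 1 / s\<close> this is \<open>y ^ n \<le> 2 * exp y\<close>, which the quadratic Taylor polynomial of the
  exponential gives for these \<open>n\<close>. It makes all integrands below bounded, so that integrability on
  finite measure spaces is immediate.\<close>

lemma flat_exp_le: "n \<le> 2 \<Longrightarrow> flat_exp n s \<le> 2"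
proof (cases "s > 0")
  case True
  assume "n \<le> 2"
  define y where "y = 1 / s"
  have y: "y > 0" using True by (simp add: y_def)
  have "y ^ n \<le> 2 * (1 + y + y\<^sup>2 / 2)"
  proof -
    consider "n = 0" | "n = 1" | "n = 2" using \<open>n \<le> 2\<close> by linarith
    then show ?thesis using y by cases (auto simp: add_nonneg_nonneg)
  qed
  also have "\<dots> \<le> 2 * exp y"
    using exp_lower_Taylor_quadratic[of y] y by simp
  finally have "y ^ n * exp (- y) \<le> 2 * exp y * exp (- y)"
    by (intro mult_right_mono) auto
  then show ?thesis
    using True by (simp add: flat_exp_def y_def mult.assoc flip: exp_add)
qed (simp add: flat_exp_def)

lemma borel_measurable_flat_exp [measurable]: "flat_exp n \<in> borel_measurable borel"
  using flat_exp_smooth[of 0 n] by (intro borel_measurable_continuous_onI) simp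

lemma flat_exp_0_has_derivative: "(flat_exp 0 has_real_derivative flat_exp 2 s) (at s)"
  using flat_exp_has_derivative[of 0 s] by (simp add: numeral_2_eq_2)

section \<open>Slices, representatives and null sets\<close>

text \<open>Fubini for null sets, with the last variable (time) outermost. The Lebesgue measure on a product
  is not the product of the Lebesgue measures but its completion, which is why the argument passes
  through Borel measure.\<close>

lemma AE_lebesgue_on_slices:
  fixes A :: "'a::euclidean_space set" and B :: "'b::euclidean_space set"
  assumes A: "A \<in> sets borel" and B: "B \<in> sets borel"
    and P: "AE z in lebesgue_on (A \<times> B). P z"
  shows "AE t in lebesgue_on B. AE x in lebesgue_on A. P (x, t)"
proof -
  have AB: "A \<times> B \<in> sets borel"
    using A B by (simp add: borel_Times)
  have "AE z in lborel. z \<in> A \<times> B \<longrightarrow> P z"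
    using P AB by (simp add: AE_restrict_space_iff AE_completion_iff)
  then have "AE z in lborel \<Otimes>\<^sub>M lborel. z \<in> A \<times> B \<longrightarrow> P z"
    unfolding lborel_prod .
  then have "AE z in distr (lborel \<Otimes>\<^sub>M lborel) (lborel \<Otimes>\<^sub>M lborel) (\<lambda>(t, x). (x, t)).
      z \<in> A \<times> B \<longrightarrow> P z"
    by (subst (asm) lborel_pair.distr_pair_swap)
  from AE_distrD[OF _ this]
  have "AE z in lborel \<Otimes>\<^sub>M lborel. (snd z, fst z) \<in> A \<times> B \<longrightarrow> P (snd z, fst z)"
    by (simp add: case_prod_beta')
  then have "AE t in lborel. AE x in lborel. x \<in> A \<and> t \<in> B \<longrightarrow> P (x, t)"
    by (auto dest: lborel_pair.AE_pair)
  then have "AE t in lborel. t \<in> B \<longrightarrow> (AE x in lborel. x \<in> A \<longrightarrow> P (x, t))"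
    by (rule AE_mp) (rule AE_I2, rename_tac t, case_tac "t \<in> B", simp_all)
  then show ?thesis
    using A B by (simp add: AE_restrict_space_iff AE_completion_iff)
qed

text \<open>Slices of a Lebesgue measurable function need not be measurable, and Fubini's theorem asks for
  measurability on the product \<open>\<sigma>\<close>-algebra. A Borel representative satisfies both; truncating it
  makes it bounded everywhere and not merely almost everywhere.\<close>

lemma bounded_borel_representative:
  fixes f :: "'a::euclidean_space \<Rightarrow> real"
  assumes S: "S \<in> sets borel" and f: "f \<in> borel_measurable (lebesgue_on S)"
    and C: "AE z in lebesgue_on S. \<bar>f z\<bar> \<le> C"
  obtains g where "g \<in> borel_measurable borel" "\<And>z. \<bar>g z\<bar> \<le> \<bar>C\<bar>" "AE z in lebesgue_on S. f z = g z"
proof -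
  have "(\<lambda>z. indicator S z * f z) \<in> borel_measurable lebesgue"
    using f S borel_measurable_restrict_space_iff[of S lebesgue f]
    by (simp add: mult.commute)
  then obtain h where h: "h \<in> borel_measurable lborel"
    and fh: "AE z in lborel. indicator S z * f z = h z"
    using completion_ex_borel_measurable_real by blast
  define g where "g z = max (- \<bar>C\<bar>) (min \<bar>C\<bar> (h z))" for z
  show thesis
  proof
    show "g \<in> borel_measurable borel"
      using h by (auto simp: g_def[abs_def])
    show "\<bar>g z\<bar> \<le> \<bar>C\<bar>" for z
      by (auto simp: g_def)
    have "AE z in lborel. z \<in> S \<longrightarrow> f z = h z"
      using fh by (rule AE_mp) (auto simp: indicator_def)
    then have "AE z in lebesgue_on S. f z = h z"
      using S by (simp add: AE_restrict_space_iff AE_completion_iff)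
    with C show "AE z in lebesgue_on S. f z = g z"
      by eventually_elim (auto simp: g_def)
  qed
qed

lemma borel_measurable_lebesgue_onI:
  "f \<in> borel_measurable borel \<Longrightarrow> f \<in> borel_measurable (lebesgue_on S)"
  by (intro measurable_restrict_space1 measurable_completion) simp

text \<open>Completeness of Lebesgue measure lets an integral be computed from a representative without
  knowing beforehand that the original function is measurable.\<close>

lemma borel_measurable_lebesgue_on_AE:
  fixes f g :: "'a::euclidean_space \<Rightarrow> real"
  assumes S: "S \<in> sets borel" and g: "g \<in> borel_measurable (lebesgue_on S)"
    and eq: "AE z in lebesgue_on S. f z = g z"
  shows "f \<in> borel_measurable (lebesgue_on S)"
proof -
  have "(\<lambda>z. indicator S z * g z) \<in> borel_measurable lebesgue"
    using g S borel_measurable_restrict_space_iff[of S lebesgue g] by (simp add: mult.commute)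
  moreover have "AE z in lebesgue. indicator S z * g z = indicator S z * f z"
    using eq S by (simp add: AE_restrict_space_iff) (auto elim!: AE_mp)
  ultimately have "(\<lambda>z. indicator S z * f z) \<in> borel_measurable lebesgue"
    by (rule borel_measurable_AE)
  then show ?thesis
    using S borel_measurable_restrict_space_iff[of S lebesgue f] by (simp add: mult.commute)
qed

lemma integral_lebesgue_on_cong_AE:
  fixes f g :: "'a::euclidean_space \<Rightarrow> real"
  assumes S: "S \<in> sets borel" and g: "g \<in> borel_measurable (lebesgue_on S)"
    and eq: "AE z in lebesgue_on S. f z = g z"
  shows "integral\<^sup>L (lebesgue_on S) f = integral\<^sup>L (lebesgue_on S) g"
  using borel_measurable_lebesgue_on_AE[OF assms] g eq by (rule integral_cong_AE)

lemma borel_measurable_vector_pair: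
  "(\<lambda>(a, b). vector [a, b] :: real^2) \<in> borel_measurable (lborel \<Otimes>\<^sub>M lborel)"
proof -
  have "(\<lambda>(a, b). vector [a, b] :: real^2) = (\<lambda>p. fst p *\<^sub>R axis 1 1 + snd p *\<^sub>R axis 2 1)"
    by (auto simp: fun_eq_iff vec_eq_iff forall_2 axis_def)
  then show ?thesis by simp
qed

text \<open>The type \<open>real^2\<close> is a function space and not a product, so Fubini's theorem in the plane is
  transported along the identification of pairs with vectors.\<close>

lemma lborel_plane_eq: "lborel = distr (lborel \<Otimes>\<^sub>M lborel) borel (\<lambda>(a, b). vector [a, b] :: real^2)"
proof (rule lborel_eqI)
  let ?V = "\<lambda>(a::real, b::real). vector [a, b] :: real^2"
  have V: "?V \<in> borel_measurable (lborel \<Otimes>\<^sub>M lborel)"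
    by (rule borel_measurable_vector_pair)
  have B: "Basis = {axis 1 1, axis 2 (1::real) :: real^2}"
    by (auto simp: Basis_vec_def UNIV_2)
  have ne: "axis 1 1 \<noteq> (axis 2 (1::real) :: real^2)"
    by (simp add: axis_eq_axis)
  fix l u :: "real^2"
  assume lu: "\<And>b. b \<in> Basis \<Longrightarrow> l \<bullet> b \<le> u \<bullet> b"
  then have le: "l $ 1 \<le> u $ 1" "l $ 2 \<le> u $ 2"
    using lu[of "axis 1 1"] lu[of "axis 2 1"] by (auto simp: B inner_axis)
  have "?V -` box l u = box (l$1) (u$1) \<times> box (l$2) (u$2)"
    by (auto simp: mem_box_cart forall_2)
  then show "emeasure (distr (lborel \<Otimes>\<^sub>M lborel) borel ?V) (box l u) = (\<Prod>b\<in>Basis. (u - l) \<bullet> b)"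
    using V le by (simp add: emeasure_distr space_pair_measure lborel.emeasure_pair_measure_Times
        B ne inner_axis inner_diff_left ennreal_mult')
qed simp

lemma AE_plane_slices:
  assumes "AE x in lborel. P (x :: real^2)"
  shows "AE a in lborel. AE b in lborel. P (vector [a, b])"
proof -
  have "AE p in lborel \<Otimes>\<^sub>M lborel. P (vector [fst p, snd p])"
    using AE_distrD[OF borel_measurable_vector_pair, of P, folded lborel_plane_eq] assms by (simp add: case_prod_beta')
  then show ?thesis
    by (auto dest: lborel_pair.AE_pair)
qed

lemma AE_notin_open_imp_empty:
  fixes B :: "'a::euclidean_space set"
  assumes "open B" "B \<subseteq> A" "A \<in> sets borel" "AE x in lebesgue_on A. x \<notin> B"
  shows "B = {}"
proof -
  have "AE x in lborel. x \<notin> B"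
    using assms by (simp add: AE_restrict_space_iff AE_completion_iff) (auto elim: AE_mp)
  then have "B \<in> null_sets lborel"
    using assms(1) by (subst AE_iff_null_sets) auto
  then show ?thesis
    using assms(1) open_not_negligible[of B]
    by (auto simp: negligible_iff_null_sets null_sets_completionI)
qed

lemma AE_second_coordinate:
  assumes "AE b in lborel. Q b"
  shows "AE x in lborel. Q ((x :: real^2) $ 2)"
proof -
  obtain N where N: "N \<in> null_sets lborel" and sub: "{b \<in> space lborel. \<not> Q b} \<subseteq> N"
    using assms unfolding eventually_ae_filter by auto
  have [measurable]: "N \<in> sets borel" using N by auto
  have meas: "{x :: real^2. x $ 2 \<in> N} \<in> sets borel"
    by measurable
  have "emeasure lborel {x :: real^2. x $ 2 \<in> N}
      = emeasure (distr (lborel \<Otimes>\<^sub>M lborel) borel (\<lambda>(a, b). vector [a, b] :: real^2)) {x. x $ 2 \<in> N}"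
    by (simp only: lborel_plane_eq[symmetric])
  also have "\<dots> = emeasure (lborel \<Otimes>\<^sub>M lborel) ((UNIV :: real set) \<times> N)"
  proof -
    have "(\<lambda>(a, b). vector [a, b] :: real^2) -` {x. x $ 2 \<in> N} \<inter> space (lborel \<Otimes>\<^sub>M lborel) = UNIV \<times> N"
      by (auto simp: space_pair_measure)
    then show ?thesis
      by (simp only: emeasure_distr[OF borel_measurable_vector_pair meas])
  qed
  also have "\<dots> = 0"
    using N by (subst lborel.emeasure_pair_measure_Times) auto
  finally have "{x :: real^2. x $ 2 \<in> N} \<in> null_sets lborel"
    using meas by auto
  then show ?thesis
    by (rule AE_I') (use sub in auto)
qed

text \<open>The given function \<open>r\<close> may be non-measurable. By Fubini, the restriction of \<open>f\<close> to almost every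
  vertical line agrees with \<open>r\<close> almost everywhere on that line, so one such restriction can replace \<open>r\<close>.\<close>

lemma AE_eq_borel_function_of_second_coordinate:
  fixes f :: "real^2 \<Rightarrow> real"
  assumes \<Omega>: "\<Omega> = {x. -1 < x$1 \<and> x$1 < 1 \<and> -1 < x$2 \<and> x$2 < 1}"
    and f[measurable]: "f \<in> borel_measurable borel"
    and r: "AE x in lebesgue_on \<Omega>. f x = r (x $ 2)"
  obtains g where "g \<in> borel_measurable borel" "AE x in lebesgue_on \<Omega>. f x = g (x $ 2)"
proof -
  have [measurable]: "\<Omega> \<in> sets borel" unfolding \<Omega> by measurable
  have "AE x in lborel. x \<in> \<Omega> \<longrightarrow> f x = r (x $ 2)"
    using r by (simp add: AE_restrict_space_iff AE_completion_iff)
  then have *: "AE a in lborel. AE b in lborel. vector [a, b] \<in> \<Omega> \<longrightarrow> f (vector [a, b]) = r b"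
    by (auto dest: AE_plane_slices)
  have "\<exists>a\<in>{-1<..<1}. AE b in lborel. vector [a, b] \<in> \<Omega> \<longrightarrow> f (vector [a, b]) = r b"
  proof (rule ccontr)
    assume none: "\<not> ?thesis"
    from * have "AE a::real in lborel. a \<notin> {-1<..<1}"
      by (rule AE_mp) (rule AE_I2, use none in blast)
    then have "AE a::real in lebesgue_on UNIV. a \<notin> {-1<..<1}"
      by (simp add: AE_restrict_space_iff AE_completion_iff)
    then have "{-1<..<1::real} = {}"
      by (intro AE_notin_open_imp_empty[where A = UNIV]) auto
    then show False by auto
  qed
  then obtain a where a: "-1 < a" "a < 1"
    and ae: "AE b in lborel. vector [a, b] \<in> \<Omega> \<longrightarrow> f (vector [a, b]) = r b"
    by auto
  show thesis
  proof
    have "(\<lambda>b. vector [a, b] :: real^2) = (\<lambda>b. a *\<^sub>R axis 1 1 + b *\<^sub>R axis 2 1)"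
      by (auto simp: fun_eq_iff vec_eq_iff forall_2 axis_def)
    then have "(\<lambda>b. vector [a, b] :: real^2) \<in> borel_measurable borel"
      by simp
    then show "(\<lambda>b. f (vector [a, b])) \<in> borel_measurable borel"
      using f by (rule measurable_compose)
    have "AE x in lebesgue_on \<Omega>. vector [a, x$2] \<in> \<Omega> \<longrightarrow> f (vector [a, x $ 2]) = r (x $ 2)"
      using AE_second_coordinate[OF ae]
      by (simp add: AE_restrict_space_iff AE_completion_iff) (erule eventually_mono, simp)
    then show "AE x in lebesgue_on \<Omega>. f x = f (vector [a, x $ 2])"
      using r AE_space by eventually_elim (use a in \<open>auto simp: \<Omega>\<close>)
  qed
qed

lemma borel_measurable_pair_lebesgue_on:
  fixes f :: "'a::euclidean_space \<times> 'b::euclidean_space \<Rightarrow> real"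
  assumes "f \<in> borel_measurable borel"
  shows "f \<in> borel_measurable (lebesgue_on A \<Otimes>\<^sub>M lebesgue_on B)"
proof -
  have 1: "(\<lambda>x. x) \<in> measurable (lebesgue_on A) borel" "(\<lambda>x. x) \<in> measurable (lebesgue_on B) borel"
    by (rule borel_measurable_lebesgue_onI, simp)+
  have "(\<lambda>z. (fst z, snd z)) \<in> measurable (lebesgue_on A \<Otimes>\<^sub>M lebesgue_on B) (borel \<Otimes>\<^sub>M borel)"
    by (intro measurable_Pair measurable_compose[OF measurable_fst 1(1)] measurable_compose[OF measurable_snd 1(2)])
  then show ?thesis
    using measurable_compose[OF _ assms[unfolded borel_prod[symmetric]]] by simp
qed

lemma integrable_bounded_borel_pair:
  fixes f :: "'a::euclidean_space \<times> 'b::euclidean_space \<Rightarrow> real"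
  assumes "finite_measure (lebesgue_on A)" "finite_measure (lebesgue_on B)"
    and "f \<in> borel_measurable borel" and "\<And>z. \<bar>f z\<bar> \<le> C"
  shows "integrable (lebesgue_on A \<Otimes>\<^sub>M lebesgue_on B) f"
proof -
  interpret finite_measure "lebesgue_on A \<Otimes>\<^sub>M lebesgue_on B"
    using assms by (intro finite_measure_pair_measure)
  show ?thesis
    using assms by (intro integrable_const_bound[where B = C] borel_measurable_pair_lebesgue_on) auto
qed

section \<open>Vanishing mean over horizontal lines\<close>

text \<open>Smoothness follows by induction from the differential equation
  \<open>tanh' = 1 - tanh\<^sup>2\<close>, because products of \<open>C\<^sup>k\<close> functions are \<open>C\<^sup>k\<close>.\<close>

lemma tanh_smooth: "Ck_on k UNIV (tanh :: real \<Rightarrow> real)"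
proof (induction k)
  case 0
  show ?case by (auto intro: continuous_on_tanh)
next
  case (Suc k)
  have "Ck_on k UNIV (\<lambda>s::real. 1 + (-1) * (tanh s * tanh s))"
    by (intro Ck_on_add Ck_on_mult Ck_on_const Suc.IH)
  moreover have "(tanh has_real_derivative 1 + (-1) * (tanh s * tanh s)) (at s)" for s :: real
    by (auto intro!: derivative_eq_intros simp: power2_eq_square)
  ultimately show ?case
    by (intro Ck_on_real_SucI)
qed

lemma ln_cosh_has_derivative:
  "((\<lambda>s. ln (cosh s)) has_real_derivative tanh s) (at (s::real))"
  by (auto intro!: derivative_eq_intros simp: tanh_def field_simps)

lemma ln_cosh_smooth: "Ck_on k UNIV (\<lambda>s::real. ln (cosh s))"
proof (cases k)
  case 0
  show ?thesis
    unfolding 0 by (auto intro!: DERIV_continuous_on ln_cosh_has_derivative)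
next
  case (Suc l)
  show ?thesis
    unfolding Suc by (rule Ck_on_real_SucI[OF ln_cosh_has_derivative tanh_smooth])
qed

lemma borel_measurable_tanh [measurable]: "(tanh :: real \<Rightarrow> real) \<in> borel_measurable borel"
  by (intro borel_measurable_continuous_onI continuous_on_tanh continuous_on_id) simp

lemma abs_tanh_le_1: "\<bar>tanh (x::real)\<bar> \<le> 1"
  using tanh_real_lt_1[of x] tanh_real_gt_neg1[of x] by linarith

text \<open>The transition layer is centred at \<open>a + 1 / n\<close> and has width of order \<open>1 / n\<^sup>2\<close>: the shift
  beats the width, so that the level \<open>y = a\<close> itself falls on the lower side and the limit is
  expressed by the half-line \<open>{a<..}\<close> exactly.\<close>

lemma tanh_transition_limit:
  "(\<lambda>n. tanh (real n ^ 2 * (y - (a + 1 / real n)))) \<longlonglongrightarrow> (if a < y then 1 else - 1)"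
proof (cases "a < y")
  case True
  define d where "d = y - a"
  have d: "d > 0" using True by (simp add: d_def)
  have "filterlim (\<lambda>n. real n ^ 2 * (d - 1 / real n)) at_top sequentially"
    using d by real_asymp
  then show ?thesis
    using True filterlim_compose[OF tanh_real_at_top] by (simp add: d_def algebra_simps)
next
  case False
  define d where "d = a - y"
  have d: "d \<ge> 0" using False by (simp add: d_def)
  have "filterlim (\<lambda>n. real n ^ 2 * (- d - 1 / real n)) at_bot sequentially"
  proof (cases "d = 0")
    case True
    then show ?thesis by simp real_asymp
  next
    case False
    then have "d > 0" using d by simp
    then show ?thesis by real_asymp
  qed
  then show ?thesis
    using False filterlim_compose[OF tanh_real_at_bot] by (simp add: d_def algebra_simps)
qed

text \<open>Steep profiles \<open>tanh (c * (s - a))\<close> approximate the sign of \<open>s - a\<close>, so by dominated convergence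
  \<open>w\<close> integrates to zero over every set \<open>{x. a < Y x}\<close>. Hence the images under \<open>Y\<close> of the measures with
  densities \<open>w\<^sup>+\<close> and \<open>w\<^sup>-\<close> agree on half-lines, and therefore are equal. In other words, the
  conditional expectation of \<open>w\<close> given \<open>Y\<close> vanishes.\<close>

lemma integral_eq_0_if_tanh_moments_eq_0:
  fixes w Y :: "'a \<Rightarrow> real"
  assumes w: "integrable M w" and Y[measurable]: "Y \<in> borel_measurable M"
    and total: "(\<integral>x. w x \<partial>M) = 0"
    and moments: "\<And>c a. c > 0 \<Longrightarrow> (\<integral>x. w x * tanh (c * (Y x - a)) \<partial>M) = 0"
    and g[measurable]: "g \<in> borel_measurable borel" and wg: "integrable M (\<lambda>x. w x * g (Y x))"
  shows "(\<integral>x. w x * g (Y x) \<partial>M) = 0"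
proof -
  have [measurable]: "w \<in> borel_measurable M" using w by auto
  have half: "(\<integral>x. w x * indicator {a<..} (Y x) \<partial>M) = 0" for a
  proof -
    have "(\<lambda>n. \<integral>x. w x * tanh (real n ^ 2 * (Y x - (a + 1 / real n))) \<partial>M)
        \<longlonglongrightarrow> (\<integral>x. w x * (if a < Y x then 1 else - 1) \<partial>M)"
    proof (rule integral_dominated_convergence[where w = "\<lambda>x. \<bar>w x\<bar>"])
      show "AE x in M. (\<lambda>n. w x * tanh (real n ^ 2 * (Y x - (a + 1 / real n))))
          \<longlonglongrightarrow> w x * (if a < Y x then 1 else - 1)"
        by (intro AE_I2 tendsto_intros tanh_transition_limit)
      show "AE x in M. norm (w x * tanh (real n ^ 2 * (Y x - (a + 1 / real n)))) \<le> \<bar>w x\<bar>" for n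
        using abs_tanh_le_1 by (intro AE_I2) (simp add: abs_mult mult_left_le)
    qed (use w in auto)
    moreover have "(\<lambda>n. \<integral>x. w x * tanh (real n ^ 2 * (Y x - (a + 1 / real n))) \<partial>M) \<longlonglongrightarrow> 0"
    proof (rule tendsto_eventually)
      show "\<forall>\<^sub>F n in sequentially.
          (\<integral>x. w x * tanh (real n ^ 2 * (Y x - (a + 1 / real n))) \<partial>M) = 0"
        using eventually_gt_at_top[of 0] by eventually_elim (rule moments, simp)
    qed
    ultimately have "(\<integral>x. w x * (if a < Y x then 1 else - 1) \<partial>M) = 0"
      by (rule LIMSEQ_unique)
    moreover have "(\<lambda>x. w x * indicator {a<..} (Y x))
        = (\<lambda>x. (w x + w x * (if a < Y x then 1 else - 1)) / 2)"
      by (auto simp: indicator_def)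
    moreover have "integrable M (\<lambda>x. w x * (if a < Y x then 1 else - 1))"
      by (rule Bochner_Integration.integrable_bound[OF w]) auto
    ultimately show ?thesis
      using w total by simp
  qed
  define \<mu> where "\<mu> f = distr (density M (\<lambda>x. ennreal (f x))) borel Y" for f
  let ?p = "\<lambda>x. max 0 (w x)" and ?n = "\<lambda>x. max 0 (- w x)"
  have em: "emeasure (\<mu> f) {a<..} = ennreal (\<integral>x. f x * indicator {a<..} (Y x) \<partial>M)"
    if [measurable]: "f \<in> borel_measurable M" and "\<And>x. f x \<ge> 0" "integrable M f" for f a
  proof -
    have "integrable M (\<lambda>x. f x * indicator {a<..} (Y x))"
      by (rule Bochner_Integration.integrable_bound[OF that(3)]) (auto simp: indicator_def)
    then have "ennreal (\<integral>x. f x * indicator {a<..} (Y x) \<partial>M)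
        = (\<integral>\<^sup>+x. ennreal (f x * indicator {a<..} (Y x)) \<partial>M)"
      using that by (intro nn_integral_eq_integral[symmetric]) auto
    also have "\<dots> = (\<integral>\<^sup>+x. ennreal (f x) * indicator (Y -` {a<..} \<inter> space M) x \<partial>M)"
      by (intro nn_integral_cong) (auto simp: indicator_def)
    also have "\<dots> = emeasure (\<mu> f) {a<..}"
      by (simp add: \<mu>_def emeasure_distr emeasure_density)
    finally show ?thesis ..
  qed
  have pn: "integrable M ?p" "integrable M ?n"
    using w by auto
  have \<mu>_eq: "\<mu> ?p = \<mu> ?n"
  proof (rule measure_eqI_lessThan)
    show "emeasure (\<mu> ?p) {a<..} < \<infinity>" for a
      using pn by (subst em) auto
    show "emeasure (\<mu> ?p) {a<..} = emeasure (\<mu> ?n) {a<..}" for a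
    proof -
      have i: "integrable M (\<lambda>x. f x * indicator {a<..} (Y x))" if "integrable M f" for f :: "'a \<Rightarrow> real"
        using that borel_measurable_integrable[OF that]
        by (rule_tac Bochner_Integration.integrable_bound[OF that]) (auto simp: indicator_def)
      have "(\<integral>x. ?p x * indicator {a<..} (Y x) \<partial>M) - (\<integral>x. ?n x * indicator {a<..} (Y x) \<partial>M)
          = (\<integral>x. ?p x * indicator {a<..} (Y x) - ?n x * indicator {a<..} (Y x) \<partial>M)"
        by (rule Bochner_Integration.integral_diff[OF i[OF pn(1)] i[OF pn(2)], symmetric])
      also have "\<dots> = (\<integral>x. w x * indicator {a<..} (Y x) \<partial>M)"
        by (rule Bochner_Integration.integral_cong) (auto simp: max_def)
      finally show ?thesis
        using half pn by (simp add: em)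
    qed
  qed (auto simp: \<mu>_def)
  have int_\<mu>: "integral\<^sup>L (\<mu> f) g = (\<integral>x. f x * g (Y x) \<partial>M)"
    if [measurable]: "f \<in> borel_measurable M" and "\<And>x. f x \<ge> 0" for f
    using that by (simp add: \<mu>_def integral_distr integral_density)
  have i: "integrable M (\<lambda>x. ?p x * g (Y x))" "integrable M (\<lambda>x. ?n x * g (Y x))"
    by (auto intro!: Bochner_Integration.integrable_bound[OF wg] simp: abs_mult mult_right_mono)
  have "(\<integral>x. w x * g (Y x) \<partial>M) = (\<integral>x. ?p x * g (Y x) - ?n x * g (Y x) \<partial>M)"
    by (rule Bochner_Integration.integral_cong) (auto simp: max_def)
  also have "\<dots> = (\<integral>x. ?p x * g (Y x) \<partial>M) - (\<integral>x. ?n x * g (Y x) \<partial>M)"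
    by (rule Bochner_Integration.integral_diff[OF i])
  also have "\<dots> = 0"
    using int_\<mu>[of ?p] int_\<mu>[of ?n] \<mu>_eq by simp
  finally show ?thesis .
qed

lemma grad_function_of_second_coordinate:
  assumes "(h has_real_derivative d) (at (x $ 2))"
  shows "grad (\<lambda>y. h (y $ 2)) x = vector [0, d]"
proof -
  have "((\<lambda>y::real^2. h (y $ 2)) has_derivative (\<lambda>w. d * w $ 2)) (at x)"
    using has_derivative_compose[OF bounded_linear_imp_has_derivative[OF bounded_linear_vec_nth]
        assms[unfolded has_field_derivative_def]] by simp
  then have "frechet_derivative (\<lambda>y::real^2. h (y $ 2)) (at x) = (\<lambda>w. d * w $ 2)"
    by (simp add: frechet_derivative_at[symmetric])
  then show ?thesis
    by (simp add: grad_def vec_eq_iff forall_2 axis_def)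
qed

lemma inner_vector_second: "u \<bullet> (vector [0, d] :: real^2) = u $ 2 * d"
  by (simp add: inner_vec_def sum_2)

text \<open>A test function \<open>h (x\<^sub>2)\<close> in the weak divergence equation yields \<open>\<integral> v\<^sub>2 h'(x\<^sub>2) = 0\<close>: because no fluid
  crosses the boundary, the mean of \<open>v\<^sub>2\<close> over each horizontal line vanishes. The primitives
  \<open>h = ln (cosh (c * (s - a))) / c\<close> produce exactly the family of moments that determines this mean.\<close>

lemma no_vertical_flux:
  assumes \<Omega>: "\<Omega> \<in> sets borel" "finite_measure (lebesgue_on \<Omega>)"
    and w[measurable]: "w \<in> borel_measurable borel" and bound: "\<And>x. \<bar>w x\<bar> \<le> C"
    and V: "AE x in lebesgue_on \<Omega>. V x $ 2 = w x"
    and div: "\<And>\<psi>. Cinf_on (closure \<Omega>) \<psi> \<Longrightarrow> (LINT x|lebesgue_on \<Omega>. V x \<bullet> grad \<psi> x) = 0"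
    and g: "g \<in> borel_measurable borel" and int: "integrable (lebesgue_on \<Omega>) (\<lambda>x. w x * g (x $ 2))"
  shows "(LINT x|lebesgue_on \<Omega>. w x * g (x $ 2)) = 0"
proof -
  have [measurable]: "(\<lambda>x::real^2. x $ 2) \<in> borel_measurable (lebesgue_on \<Omega>)"
    by (rule borel_measurable_lebesgue_onI) simp
  have w'[measurable]: "w \<in> borel_measurable (lebesgue_on \<Omega>)"
    by (rule borel_measurable_lebesgue_onI) simp
  interpret finite_measure "lebesgue_on \<Omega>" by fact
  have wint: "integrable (lebesgue_on \<Omega>) w"
    using bound w' by (intro integrable_const_bound[where B = C]) auto
  have test: "(LINT x|lebesgue_on \<Omega>. w x * h' (x $ 2)) = 0"
    if h: "\<And>s. (h has_real_derivative h' s) (at s)" "\<And>k. Ck_on k UNIV h"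
      and h'[measurable]: "h' \<in> borel_measurable borel" for h h' :: "real \<Rightarrow> real"
  proof -
    have sm: "Cinf_on (closure \<Omega>) (\<lambda>x::real^2. h (x $ 2))"
      using Ck_on_compose_affine[OF bounded_linear_vec_nth h(2), where c = 0] by (intro Cinf_onI) simp
    have "(LINT x|lebesgue_on \<Omega>. V x \<bullet> grad (\<lambda>x. h (x $ 2)) x) = (LINT x|lebesgue_on \<Omega>. w x * h' (x $ 2))"
      using V by (intro integral_lebesgue_on_cong_AE \<Omega>)
        (auto simp: grad_function_of_second_coordinate[OF h(1)] inner_vector_second)
    with div[OF sm] show ?thesis by simp
  qed
  show ?thesis
  proof (rule integral_eq_0_if_tanh_moments_eq_0[OF wint _ _ _ g int])
    have "Ck_on k UNIV (\<lambda>s::real. s)" for k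
      by (cases k) (auto intro!: Ck_on_real_SucI[where h' = "\<lambda>_. 1"] Ck_on_const derivative_eq_intros)
    then show "(LINT x|lebesgue_on \<Omega>. w x) = 0"
      using test[of "\<lambda>s. s" "\<lambda>_. 1"] by (auto intro!: derivative_eq_intros)
    show "(LINT x|lebesgue_on \<Omega>. w x * tanh (c * (x $ 2 - a))) = 0" if "c > 0" for c a
    proof (rule test[where h = "\<lambda>s. (1 / c) * ln (cosh (c * s + (- c * a)))"])
      show "((\<lambda>s. (1 / c) * ln (cosh (c * s + (- c * a)))) has_real_derivative tanh (c * (s - a))) (at s)" for s
        using that by (auto intro!: derivative_eq_intros simp: tanh_def field_simps)
      show "Ck_on k UNIV (\<lambda>s. (1 / c) * ln (cosh (c * s + (- c * a))))" for k
        using Ck_on_compose_affine[OF bounded_linear_mult_right[of c] ln_cosh_smooth[of k]]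
        by (intro Ck_on_mult Ck_on_const)
    qed measurable
  qed auto
qed

section \<open>Dissipation on a time slice\<close>

text \<open>This is the pointwise inequality behind the speed 2, on one time slice. Write \<open>u = 1 - \<sigma> R\<close>, so that
  \<open>u \<ge> 0\<close> and \<open>1 - R\<^sup>2 = u (2 - u)\<close>. The transport part \<open>R w\<close> of the flux \<open>\<mu>\<close> has zero mean
  on horizontal lines and drops out of the integral, although it may have either sign pointwise. What is
  left of \<open>\<mu>\<close> is at least \<open>- u (2 - u)\<close>, and the term \<open>2 u\<close> coming from a weight that moves with speed 2
  compensates it: \<open>2 u - u (2 - u) = u\<^sup>2 \<ge> 0\<close>.

  Here \<open>h\<close> and \<open>h'\<close> stand for the spatial profile of the weight and its derivative, \<open>A\<close> and \<open>B\<close>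
  for minus the derivative and the value of the temporal cut-off.\<close>

lemma slice_dissipation:
  fixes R w \<mu> :: "real^2 \<Rightarrow> real" and h h' :: "real \<Rightarrow> real"
  assumes \<Omega>: "\<Omega> \<in> sets borel" "finite_measure (lebesgue_on \<Omega>)"
    and \<sigma>: "\<sigma> = 1 \<or> \<sigma> = - 1"
    and R[measurable]: "R \<in> borel_measurable borel" and w[measurable]: "w \<in> borel_measurable borel"
    and \<mu>[measurable]: "\<mu> \<in> borel_measurable borel"
    and bound: "\<And>x. \<bar>R x\<bar> \<le> C" "\<And>x. \<bar>w x\<bar> \<le> C" "\<And>x. \<bar>\<mu> x\<bar> \<le> C"
    and hull: "AE x in lebesgue_on \<Omega>. \<bar>R x\<bar> \<le> 1 \<and> - (1 - (R x)\<^sup>2) \<le> \<mu> x - R x * w x"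
    and g[measurable]: "g \<in> borel_measurable borel" and Rg: "AE x in lebesgue_on \<Omega>. R x = g (x $ 2)"
    and flux: "\<And>k. k \<in> borel_measurable borel \<Longrightarrow> integrable (lebesgue_on \<Omega>) (\<lambda>x. w x * k (x $ 2)) \<Longrightarrow>
        (LINT x|lebesgue_on \<Omega>. w x * k (x $ 2)) = 0"
    and h[measurable]: "h \<in> borel_measurable borel" and h'[measurable]: "h' \<in> borel_measurable borel"
    and hb: "\<And>s. 0 \<le> h s \<and> h s \<le> D" "\<And>s. 0 \<le> h' s \<and> h' s \<le> D"
    and AB: "0 \<le> A" "0 \<le> B"
  defines "F \<equiv> \<lambda>x. (1 - \<sigma> * R x) * (A * h (x $ 2) + 2 * B * h' (x $ 2)) + \<mu> x * (B * h' (x $ 2))"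
  shows "0 \<le> integral\<^sup>L (lebesgue_on \<Omega>) F"
    and "integral\<^sup>L (lebesgue_on \<Omega>) F = 0 \<Longrightarrow>
      AE x in lebesgue_on \<Omega>. A * h (x $ 2) * (1 - \<sigma> * R x) = 0"
proof -
  let ?N = "lebesgue_on \<Omega>"
  interpret finite_measure ?N by fact
  have [measurable]: "(\<lambda>x::real^2. x $ 2) \<in> borel_measurable ?N" "R \<in> borel_measurable ?N"
    "w \<in> borel_measurable ?N" "\<mu> \<in> borel_measurable ?N"
    by (rule borel_measurable_lebesgue_onI, simp)+
  let ?q = "\<lambda>x::real^2. B * h' (x $ 2)"
  let ?E = "\<lambda>x. F x - w x * (R x * ?q x)"
  have C0: "0 \<le> C" using bound(1)[of 0] by linarith
  have D0: "0 \<le> D" using hb(1)[of 0] by linarith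
  have qb: "\<bar>?q x\<bar> \<le> B * D" for x
    using hb(2)[of "x $ 2"] AB by (simp add: abs_mult mult_left_mono)
  have int1: "integrable ?N (\<lambda>x. w x * (R x * ?q x))"
  proof (rule integrable_const_bound[where B = "C * (C * (B * D))"])
    show "AE x in ?N. norm (w x * (R x * ?q x)) \<le> C * (C * (B * D))"
      unfolding real_norm_def abs_mult[of "w _"] abs_mult[of "R _"]
      using bound qb C0 AB D0 by (intro AE_I2 mult_mono) auto
  qed measurable
  have intF: "integrable ?N F"
    unfolding F_def
  proof (intro Bochner_Integration.integrable_add)
    show "integrable ?N (\<lambda>x. (1 - \<sigma> * R x) * (A * h (x $ 2) + 2 * B * h' (x $ 2)))"
    proof (rule integrable_const_bound[where B = "(1 + C) * (A * D + 2 * B * D)"])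
      have "\<bar>1 - \<sigma> * R x\<bar> \<le> 1 + C" for x
        using \<sigma> bound(1)[of x] by auto
      moreover have "\<bar>A * h (x $ 2) + 2 * B * h' (x $ 2)\<bar> \<le> A * D + 2 * B * D" for x :: "real^2"
        using hb[of "x $ 2"] AB by (simp add: abs_of_nonneg add_mono mult_left_mono)
      ultimately show "AE x in ?N. norm ((1 - \<sigma> * R x) * (A * h (x $ 2) + 2 * B * h' (x $ 2)))
          \<le> (1 + C) * (A * D + 2 * B * D)"
        unfolding real_norm_def abs_mult[of "1 - _"] using C0 by (intro AE_I2 mult_mono) auto
    qed measurable
    show "integrable ?N (\<lambda>x. \<mu> x * (B * h' (x $ 2)))"
    proof (rule integrable_const_bound[where B = "C * (B * D)"])
      show "AE x in ?N. norm (\<mu> x * (B * h' (x $ 2))) \<le> C * (B * D)"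
        unfolding real_norm_def abs_mult[of "\<mu> _"]
        using bound qb C0 by (intro AE_I2 mult_mono) auto
    qed measurable
  qed
  have "(LINT x|?N. w x * (R x * ?q x)) = 0"
  proof -
    have ae: "AE x in ?N. w x * (R x * ?q x) = w x * (g (x $ 2) * ?q x)"
      using Rg by eventually_elim simp
    have "integrable ?N (\<lambda>x. w x * (g (x $ 2) * ?q x))"
      by (rule integrable_cong_AE_imp[OF int1 _ ae]) measurable
    then have "(LINT x|?N. w x * (g (x $ 2) * ?q x)) = 0"
      by (intro flux[where k = "\<lambda>s. g s * (B * h' s)"]) auto
    moreover have "(LINT x|?N. w x * (R x * ?q x)) = (LINT x|?N. w x * (g (x $ 2) * ?q x))"
      by (rule integral_cong_AE[OF _ _ ae]) measurable
    ultimately show ?thesis by simp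
  qed
  then have eq: "integral\<^sup>L ?N ?E = integral\<^sup>L ?N F"
    using intF int1 by simp
  have intE: "integrable ?N ?E"
    using intF int1 by simp
  have E: "AE x in ?N. 0 \<le> A * h (x $ 2) * (1 - \<sigma> * R x) \<and> A * h (x $ 2) * (1 - \<sigma> * R x) \<le> ?E x"
    using hull
  proof eventually_elim
    case (elim x)
    have u: "0 \<le> 1 - \<sigma> * R x" using \<sigma> elim by auto
    have q: "0 \<le> ?q x" using hb AB by simp
    have "- (1 - (R x)\<^sup>2) * ?q x \<le> (\<mu> x - R x * w x) * ?q x"
      using elim q by (intro mult_right_mono) auto
    moreover have "(1 - \<sigma> * R x) * (2 * ?q x) - (1 - (R x)\<^sup>2) * ?q x = (1 - \<sigma> * R x)\<^sup>2 * ?q x"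
      using \<sigma> by (auto simp: power2_eq_square algebra_simps)
    moreover have "0 \<le> (1 - \<sigma> * R x)\<^sup>2 * ?q x"
      using q by simp
    moreover have "?E x = A * h (x $ 2) * (1 - \<sigma> * R x) + (1 - \<sigma> * R x) * (2 * ?q x)
        + (\<mu> x - R x * w x) * ?q x"
      by (simp add: F_def algebra_simps)
    ultimately have "A * h (x $ 2) * (1 - \<sigma> * R x) \<le> ?E x"
      by linarith
    then show ?case
      using u AB hb by simp
  qed
  have nonneg: "AE x in ?N. 0 \<le> ?E x"
    using E by eventually_elim linarith
  show "0 \<le> integral\<^sup>L ?N F"
    using integral_nonneg_AE[OF nonneg] eq by simp
  show "AE x in ?N. A * h (x $ 2) * (1 - \<sigma> * R x) = 0" if "integral\<^sup>L ?N F = 0"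
  proof -
    have "AE x in ?N. ?E x = 0"
      using integral_nonneg_eq_0_iff_AE[OF intE nonneg] eq that by simp
    with E show ?thesis
      by eventually_elim linarith
  qed
qed

section \<open>Test functions supported outside the cone\<close>

text \<open>For \<open>\<sigma> = 1\<close> this weight is positive exactly on \<open>{(x, t). t < \<tau>, 2 t < x\<^sub>2}\<close>, and for \<open>\<sigma> = -1\<close> on the
  reflected region. The first factor is strictly decreasing in time where it is positive, and the second
  moves with speed 2 away from the interface.\<close>

definition cone_test :: "real \<Rightarrow> real \<Rightarrow> (real^2) \<times> real \<Rightarrow> real" where
  "cone_test \<sigma> \<tau> = (\<lambda>(x, t). flat_exp 0 (\<tau> - t) * flat_exp 0 (\<sigma> * x $ 2 - 2 * t))"

definition cone_test_dt :: "real \<Rightarrow> real \<Rightarrow> (real^2) \<times> real \<Rightarrow> real" where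
  "cone_test_dt \<sigma> \<tau> = (\<lambda>(x, t). - (flat_exp 2 (\<tau> - t) * flat_exp 0 (\<sigma> * x $ 2 - 2 * t)
      + 2 * flat_exp 0 (\<tau> - t) * flat_exp 2 (\<sigma> * x $ 2 - 2 * t)))"

definition cone_test_d2 :: "real \<Rightarrow> real \<Rightarrow> (real^2) \<times> real \<Rightarrow> real" where
  "cone_test_d2 \<sigma> \<tau> = (\<lambda>(x, t). \<sigma> * (flat_exp 0 (\<tau> - t) * flat_exp 2 (\<sigma> * x $ 2 - 2 * t)))"

lemma cone_test_has_dt:
  "((\<lambda>s. cone_test \<sigma> \<tau> (x, s)) has_real_derivative cone_test_dt \<sigma> \<tau> (x, t)) (at t within S)"
  unfolding cone_test_def cone_test_dt_def
  by (rule derivative_eq_intros refl DERIV_chain2[OF flat_exp_0_has_derivative] | simp)+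

lemma grad_cone_test: "grad (\<lambda>y. cone_test \<sigma> \<tau> (y, t)) x = vector [0, cone_test_d2 \<sigma> \<tau> (x, t)]"
  unfolding cone_test_def cone_test_d2_def split
  by (rule grad_function_of_second_coordinate[where
        h = "\<lambda>s. flat_exp 0 (\<tau> - t) * flat_exp 0 (\<sigma> * s - 2 * t)"])
    (rule derivative_eq_intros refl DERIV_chain2[OF flat_exp_0_has_derivative] | simp)+

lemma cone_test_admissible:
  assumes "bounded \<Omega>" and "\<tau> < T"
  shows "Cinf_c_on (closure \<Omega> \<times> {0..<T}) (cone_test \<sigma> \<tau>)"
  unfolding Cinf_c_on_def
proof (intro conjI exI)
  have "bounded_linear (\<lambda>z :: (real^2) \<times> real. - snd z)"
    by (intro bounded_linear_minus bounded_linear_snd)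
  moreover have "bounded_linear (\<lambda>z :: (real^2) \<times> real. \<sigma> * fst z $ 2 - 2 * snd z)"
    by (intro bounded_linear_sub bounded_linear_const_mult bounded_linear_snd
        bounded_linear_compose[OF bounded_linear_vec_nth] bounded_linear_fst)
  ultimately have "Ck_on k UNIV (\<lambda>z :: (real^2) \<times> real.
      flat_exp 0 (- snd z + \<tau>) * flat_exp 0 (\<sigma> * fst z $ 2 - 2 * snd z + 0))" for k
    by (intro Ck_on_mult Ck_on_compose_affine flat_exp_smooth)
  then show "Cinf_on (closure \<Omega> \<times> {0..<T}) (cone_test \<sigma> \<tau>)"
    by (intro Cinf_onI) (simp add: cone_test_def case_prod_beta')
  show "compact (closure \<Omega> \<times> {0..\<tau>})"
    using assms by (intro compact_Times) auto
  show "closure \<Omega> \<times> {0..\<tau>} \<subseteq> closure \<Omega> \<times> {0..<T}"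
    using assms by auto
  show "\<forall>z\<in>closure \<Omega> \<times> {0..<T} - closure \<Omega> \<times> {0..\<tau>}. cone_test \<sigma> \<tau> z = 0"
    by (auto simp: cone_test_def flat_exp_eq_0_iff)
qed

lemma cone_test_measurable [measurable]:
  "cone_test \<sigma> \<tau> \<in> borel_measurable borel" "cone_test_dt \<sigma> \<tau> \<in> borel_measurable borel"
  "cone_test_d2 \<sigma> \<tau> \<in> borel_measurable borel"
proof -
  have [measurable]: "(\<lambda>z::(real^2) \<times> real. fst z $ 2) \<in> borel_measurable borel"
    "(snd :: (real^2) \<times> real \<Rightarrow> real) \<in> borel_measurable borel"
    by (intro borel_measurable_continuous_onI continuous_intros)+
  show "cone_test \<sigma> \<tau> \<in> borel_measurable borel" "cone_test_dt \<sigma> \<tau> \<in> borel_measurable borel"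
    "cone_test_d2 \<sigma> \<tau> \<in> borel_measurable borel"
    unfolding cone_test_def cone_test_dt_def cone_test_d2_def case_prod_beta' by measurable
qed

lemma cone_test_bounds:
  "\<bar>cone_test_dt \<sigma> \<tau> z\<bar> \<le> 12" "\<sigma> = 1 \<or> \<sigma> = -1 \<Longrightarrow> \<bar>cone_test_d2 \<sigma> \<tau> z\<bar> \<le> 4"
proof -
  have b: "\<bar>flat_exp m a * flat_exp n b\<bar> \<le> 4" if "m \<le> 2" "n \<le> 2" for m n a b
    using mult_mono[OF flat_exp_le[OF that(1), of a] flat_exp_le[OF that(2), of b]]
    by (simp add: abs_mult flat_exp_nonneg)
  obtain x t where z: "z = (x, t)" by fastforce
  show "\<bar>cone_test_dt \<sigma> \<tau> z\<bar> \<le> 12"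
    using b[of 2 0 "\<tau> - t" "\<sigma> * x $ 2 - 2 * t"] b[of 0 2 "\<tau> - t" "\<sigma> * x $ 2 - 2 * t"]
    by (simp add: z cone_test_dt_def mult.assoc)
  show "\<bar>cone_test_d2 \<sigma> \<tau> z\<bar> \<le> 4" if "\<sigma> = 1 \<or> \<sigma> = -1"
    using b[of 0 2 "\<tau> - t" "\<sigma> * x $ 2 - 2 * t"] that
    by (auto simp: z cone_test_d2_def abs_mult)
qed

text \<open>This computes the contribution of the constant state \<open>\<sigma>\<close> to the weak continuity equation; subtracting
  it leaves an equation for \<open>\<rho> - \<sigma>\<close>.\<close>

lemma integral_cone_test_dt:
  assumes "0 < T" "\<tau> < T"
  shows "(LINT t|lebesgue_on {0<..<T}. cone_test_dt \<sigma> \<tau> (x, t)) = - cone_test \<sigma> \<tau> (x, 0)"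
proof -
  have "((\<lambda>t. cone_test_dt \<sigma> \<tau> (x, t)) has_integral cone_test \<sigma> \<tau> (x, T) - cone_test \<sigma> \<tau> (x, 0)) {0..T}"
    using assms by (intro fundamental_theorem_of_calculus)
      (auto simp: cone_test_has_dt has_real_derivative_iff_has_vector_derivative[symmetric])
  moreover have "cone_test \<sigma> \<tau> (x, T) = 0"
    using assms by (simp add: cone_test_def flat_exp_eq_0_iff)
  ultimately have "integral {0<..<T} (\<lambda>t. cone_test_dt \<sigma> \<tau> (x, t)) = - cone_test \<sigma> \<tau> (x, 0)"
    by (simp add: integral_open_interval_real[symmetric] integral_unique)
  moreover have "integrable (lebesgue_on {0<..<T}) (\<lambda>t. cone_test_dt \<sigma> \<tau> (x, t))"
  proof -
    interpret finite_measure "lebesgue_on {0<..<T}"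
      by (intro finite_measure_lebesgue_on lmeasurable_open) auto
    have "(\<lambda>t. cone_test_dt \<sigma> \<tau> (x, t)) \<in> borel_measurable borel"
      unfolding cone_test_dt_def split by measurable
    then show ?thesis
      using cone_test_bounds(1)
      by (intro integrable_const_bound[where B = 12] borel_measurable_lebesgue_onI) auto
  qed
  ultimately show ?thesis
    by (simp add: lebesgue_integral_eq_integral)
qed

section \<open>Finite speed of propagation\<close>

text \<open>The weak continuity equation with the weight \<^const>\<open>cone_test\<close>, minus the same identity for the constant
  state \<open>\<sigma>\<close>, has no initial term: the weight at time zero is supported where \<open>\<rho>0 = \<sigma>\<close>. So the time integral
  of the slice integrals vanishes. Each slice integral has a sign by the dissipation inequality; hence
  almost all of them are zero, and then so is the nonnegative density \<open>u = 1 - \<sigma> \<rho>\<close> wherever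
  the weight is positive.\<close>

lemma subsolution_constant_outside_cone:
  assumes \<Omega>: "\<Omega> = {x. -1 < x$1 \<and> x$1 < 1 \<and> -1 < x$2 \<and> x$2 < 1}"
    and T: "T > 0" and \<tau>: "\<tau> < T"
    and \<sigma>: "\<sigma> = 1 \<or> \<sigma> = -1"
    and \<rho>0: "\<And>x. \<sigma> * x $ 2 > 0 \<Longrightarrow> \<rho>0 x = \<sigma>"
    and Linf: "Linf_on (\<Omega> \<times> {0<..<T}) (\<lambda>z. (\<rho> z, v z, m z))"
    and cont: "weak_continuity_eq \<Omega> T \<rho>0 \<rho> m"
    and div: "weak_div_free \<Omega> T v"
    and hull: "AE z in lebesgue_on (\<Omega> \<times> {0<..<T}).
        hull_defect (\<rho> z) (v z) (m z) \<le> (1/2) * (1 - (\<rho> z)\<^sup>2)"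
    and indep: "AE z in lebesgue_on (\<Omega> \<times> {0<..<T}). \<rho> z = r (fst z $ 2) (snd z)"
  shows "AE t in lebesgue_on {0<..<T}. AE x in lebesgue_on \<Omega>.
      t < \<tau> \<and> 2 * t < \<sigma> * x $ 2 \<longrightarrow> \<rho> (x, t) = \<sigma>"
proof -
  let ?I = "{0<..<T}" and ?N = "lebesgue_on \<Omega>"
  let ?L = "lebesgue_on ?I" and ?Q = "lebesgue_on (\<Omega> \<times> {0<..<T})"
  let ?\<phi> = "cone_test \<sigma> \<tau>" and ?a = "cone_test_dt \<sigma> \<tau>" and ?b = "cone_test_d2 \<sigma> \<tau>"
  have \<Omega>_box: "\<Omega> = box (vector [-1, -1]) (vector [1, 1])"
    by (auto simp: \<Omega> mem_box_cart forall_2)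
  have \<Omega>_open: "open \<Omega>" and \<Omega>_bdd: "bounded \<Omega>"
    unfolding \<Omega>_box by (auto intro: bounded_box)
  have \<Omega>_borel: "\<Omega> \<in> sets borel" and I_borel: "?I \<in> sets borel"
    using \<Omega>_open by auto
  have Q_borel: "\<Omega> \<times> ?I \<in> sets borel"
    using \<Omega>_borel I_borel by (simp add: borel_Times)
  have finN: "finite_measure ?N" and finL: "finite_measure ?L"
    using \<Omega>_open \<Omega>_bdd by (intro finite_measure_lebesgue_on lmeasurable_open; simp)+
  interpret N: finite_measure ?N by fact
  interpret L: finite_measure ?L by fact
  interpret P: pair_sigma_finite ?N ?L ..

  obtain C where meas: "(\<lambda>z. (\<rho> z, v z, m z)) \<in> borel_measurable ?Q"
    and C: "AE z in ?Q. norm (\<rho> z, v z, m z) \<le> C"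
    using Linf unfolding Linf_on_def by auto
  have meas_comp: "\<rho> \<in> borel_measurable ?Q" "(\<lambda>z. v z $ 2) \<in> borel_measurable ?Q"
      "(\<lambda>z. m z $ 2) \<in> borel_measurable ?Q"
    using measurable_compose[OF meas, of fst borel]
      measurable_compose[OF meas, of "\<lambda>p. fst (snd p) $ 2" borel]
      measurable_compose[OF meas, of "\<lambda>p. snd (snd p) $ 2" borel]
    by (simp_all add: borel_measurable_continuous_onI continuous_intros)
  have norm_comp: "\<bar>a\<bar> \<le> norm (a, b, c)" "\<bar>b $ 2\<bar> \<le> norm (a, b, c)" "\<bar>c $ 2\<bar> \<le> norm (a, b, c)"
    for a :: real and b c :: "real^2"
    using norm_fst_le[of a "(b, c)"] norm_snd_le[of "(b, c)" a] norm_fst_le[of b c] norm_snd_le[of c b]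
      component_le_norm_cart[of b 2] component_le_norm_cart[of c 2]
    by auto
  have "AE z in ?Q. \<bar>\<rho> z\<bar> \<le> C"
    using C by eventually_elim (rule order_trans[OF norm_comp(1)])
  then obtain R where R[measurable]: "R \<in> borel_measurable borel"
      and Rb: "\<And>z. \<bar>R z\<bar> \<le> \<bar>C\<bar>" and R_eq: "AE z in ?Q. \<rho> z = R z"
    using bounded_borel_representative[OF Q_borel meas_comp(1)] by blast
  have "AE z in ?Q. \<bar>v z $ 2\<bar> \<le> C"
    using C by eventually_elim (rule order_trans[OF norm_comp(2)])
  then obtain w where w[measurable]: "w \<in> borel_measurable borel"
      and wb: "\<And>z. \<bar>w z\<bar> \<le> \<bar>C\<bar>" and w_eq: "AE z in ?Q. v z $ 2 = w z"
    using bounded_borel_representative[OF Q_borel meas_comp(2)] by blast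
  have "AE z in ?Q. \<bar>m z $ 2\<bar> \<le> C"
    using C by eventually_elim (rule order_trans[OF norm_comp(3)])
  then obtain \<mu> where \<mu>[measurable]: "\<mu> \<in> borel_measurable borel"
      and \<mu>b: "\<And>z. \<bar>\<mu> z\<bar> \<le> \<bar>C\<bar>" and \<mu>_eq: "AE z in ?Q. m z $ 2 = \<mu> z"
    using bounded_borel_representative[OF Q_borel meas_comp(3)] by blast
  \<comment> \<open>The norm in the hull condition dominates the second component, which bounds the vertical flux from
     below; since the norm is nonnegative, \<open>1 - R\<^sup>2\<close> is nonnegative too.\<close>
  have "AE z in ?Q. \<bar>R z\<bar> \<le> 1 \<and> - (1 - (R z)\<^sup>2) \<le> \<mu> z - R z * w z"
    using hull R_eq w_eq \<mu>_eq
  proof eventually_elim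
    case (elim z)
    let ?d = "m z - \<rho> z *\<^sub>R v z + (1/2) *\<^sub>R vector [0, 1 - (\<rho> z)\<^sup>2]"
    have le: "norm ?d \<le> (1/2) * (1 - (\<rho> z)\<^sup>2)"
      using elim(1) by (simp add: hull_defect_def)
    have "(\<rho> z)\<^sup>2 \<le> 1"
      using order_trans[OF norm_ge_zero le] by simp
    moreover have "- ((1/2) * (1 - (\<rho> z)\<^sup>2)) \<le> ?d $ 2"
      using component_le_norm_cart[of ?d 2] le by linarith
    ultimately show ?case
      using elim(2-4) by (simp add: abs_square_le_1 field_simps)
  qed
  note hull_t = AE_lebesgue_on_slices[OF \<Omega>_borel I_borel this]
  note R_t = AE_lebesgue_on_slices[OF \<Omega>_borel I_borel R_eq]
  note w_t = AE_lebesgue_on_slices[OF \<Omega>_borel I_borel w_eq]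
  note \<mu>_t = AE_lebesgue_on_slices[OF \<Omega>_borel I_borel \<mu>_eq]
  note r_t = AE_lebesgue_on_slices[OF \<Omega>_borel I_borel indep]

  have slice: "(\<lambda>x. f (x, t)) \<in> borel_measurable borel"
    if "f \<in> borel_measurable borel" for f :: "(real^2) \<times> real \<Rightarrow> real" and t
    using that by (rule measurable_compose[rotated])
      (intro borel_measurable_continuous_onI continuous_intros)
  \<comment> \<open>The integrand of the weak continuity equation after the constant state has been subtracted.\<close>
  define G where "G = (\<lambda>(x, t). (R (x, t) - \<sigma>) * ?a (x, t) + \<mu> (x, t) * ?b (x, t))"
  have G_meas[measurable]: "G \<in> borel_measurable borel"
    unfolding G_def case_prod_beta' prod.collapse by measurable
  have Gb: "\<bar>G z\<bar> \<le> (\<bar>C\<bar> + 1) * 12 + \<bar>C\<bar> * 4" for z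
  proof -
    have "\<bar>(R z - \<sigma>) * ?a z\<bar> \<le> (\<bar>C\<bar> + 1) * 12"
      unfolding abs_mult using Rb[of z] \<sigma> cone_test_bounds(1) by (intro mult_mono) auto
    moreover have "\<bar>\<mu> z * ?b z\<bar> \<le> \<bar>C\<bar> * 4"
      unfolding abs_mult using \<mu>b[of z] cone_test_bounds(2)[OF \<sigma>] by (intro mult_mono) auto
    ultimately show ?thesis
      unfolding G_def case_prod_beta' prod.collapse by linarith
  qed
  have G_int: "integrable (?N \<Otimes>\<^sub>M ?L) G"
    by (rule integrable_bounded_borel_pair[OF finN finL G_meas Gb])
  have a_int: "integrable (?N \<Otimes>\<^sub>M ?L) ?a"
    by (rule integrable_bounded_borel_pair[OF finN finL _ cone_test_bounds(1)]) measurable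
  have inner_G: "integrable ?L (\<lambda>t. LINT x|?N. G (x, t))"
    and inner_a: "integrable ?L (\<lambda>t. LINT x|?N. ?a (x, t))"
    using P.integrable_snd[of "\<lambda>x t. G (x, t)"] P.integrable_snd[of "\<lambda>x t. ?a (x, t)"] G_int a_int
    by simp_all
  have G_slice: "(LINT x|?N. R (x, t) * ?a (x, t) + \<mu> (x, t) * ?b (x, t))
      = (LINT x|?N. G (x, t)) + \<sigma> * (LINT x|?N. ?a (x, t))" for t
  proof -
    have "integrable ?N (\<lambda>x. G (x, t))"
      using Gb by (intro N.integrable_const_bound[where B = "(\<bar>C\<bar> + 1) * 12 + \<bar>C\<bar> * 4"] borel_measurable_lebesgue_onI slice G_meas) auto
    moreover have "integrable ?N (\<lambda>x. ?a (x, t))"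
      using cone_test_bounds(1)
      by (intro N.integrable_const_bound[where B = 12] borel_measurable_lebesgue_onI slice cone_test_measurable) auto
    ultimately have "(LINT x|?N. G (x, t) + \<sigma> * ?a (x, t))
        = (LINT x|?N. G (x, t)) + \<sigma> * (LINT x|?N. ?a (x, t))"
      by simp
    then show ?thesis
      by (simp add: G_def algebra_simps)
  qed
  have total: "(LINT t|?L. LINT x|?N. G (x, t)) = 0"
  proof -
    have "(LINT t|?L. LINT x|?N. \<rho> (x, t) * deriv (\<lambda>s. ?\<phi> (x, s)) t + m (x, t) \<bullet> grad (\<lambda>y. ?\<phi> (y, t)) x)
        = (LINT t|?L. (LINT x|?N. G (x, t)) + \<sigma> * (LINT x|?N. ?a (x, t)))"
    proof (rule integral_lebesgue_on_cong_AE[OF I_borel])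
      show "(\<lambda>t. (LINT x|?N. G (x, t)) + \<sigma> * (LINT x|?N. ?a (x, t))) \<in> borel_measurable ?L"
        using inner_G inner_a by auto
      show "AE t in ?L. (LINT x|?N. \<rho> (x, t) * deriv (\<lambda>s. ?\<phi> (x, s)) t + m (x, t) \<bullet> grad (\<lambda>y. ?\<phi> (y, t)) x)
          = (LINT x|?N. G (x, t)) + \<sigma> * (LINT x|?N. ?a (x, t))"
        using R_t \<mu>_t
      proof eventually_elim
        case (elim t)
        have d: "deriv (\<lambda>s. ?\<phi> (x, s)) t = ?a (x, t)" for x
          by (rule DERIV_imp_deriv[OF cone_test_has_dt])
        have "(LINT x|?N. \<rho> (x, t) * deriv (\<lambda>s. ?\<phi> (x, s)) t + m (x, t) \<bullet> grad (\<lambda>y. ?\<phi> (y, t)) x)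
            = (LINT x|?N. R (x, t) * ?a (x, t) + \<mu> (x, t) * ?b (x, t))"
        proof (rule integral_lebesgue_on_cong_AE[OF \<Omega>_borel])
          have [measurable]: "(\<lambda>x. R (x, t)) \<in> borel_measurable borel" "(\<lambda>x. ?a (x, t)) \<in> borel_measurable borel"
            "(\<lambda>x. \<mu> (x, t)) \<in> borel_measurable borel" "(\<lambda>x. ?b (x, t)) \<in> borel_measurable borel"
            by (intro slice R \<mu> cone_test_measurable)+
          show "(\<lambda>x. R (x, t) * ?a (x, t) + \<mu> (x, t) * ?b (x, t)) \<in> borel_measurable ?N"
            by (rule borel_measurable_lebesgue_onI) measurable
          show "AE x in ?N. \<rho> (x, t) * deriv (\<lambda>s. ?\<phi> (x, s)) t + m (x, t) \<bullet> grad (\<lambda>y. ?\<phi> (y, t)) x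
              = R (x, t) * ?a (x, t) + \<mu> (x, t) * ?b (x, t)"
            using elim by eventually_elim (simp add: d grad_cone_test inner_vector_second)
        qed
        then show ?case using G_slice by simp
      qed
    qed
    also have "\<dots> = (LINT t|?L. LINT x|?N. G (x, t)) + \<sigma> * (LINT t|?L. LINT x|?N. ?a (x, t))"
      using inner_G inner_a by simp
    also have "(LINT t|?L. LINT x|?N. ?a (x, t)) = (LINT x|?N. LINT t|?L. ?a (x, t))"
      using P.Fubini_integral[of "\<lambda>x t. ?a (x, t)"] a_int by simp
    also have "\<dots> = - (LINT x|?N. ?\<phi> (x, 0))"
      using T \<tau> by (simp add: integral_cone_test_dt)
    finally have lhs: "(LINT t|?L. LINT x|?N. \<rho> (x, t) * deriv (\<lambda>s. ?\<phi> (x, s)) t + m (x, t) \<bullet> grad (\<lambda>y. ?\<phi> (y, t)) x)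
        = (LINT t|?L. LINT x|?N. G (x, t)) + \<sigma> * - (LINT x|?N. ?\<phi> (x, 0))" .
    have "?\<phi> (x, 0) * \<rho>0 x = \<sigma> * ?\<phi> (x, 0)" for x
      using \<rho>0[of x] by (cases "\<sigma> * x $ 2 > 0") (auto simp: cone_test_def flat_exp_eq_0_iff)
    then have "(LINT x|?N. ?\<phi> (x, 0) * \<rho>0 x) = \<sigma> * (LINT x|?N. ?\<phi> (x, 0))"
      by (simp only: integral_mult_right_zero)
    moreover have "(LINT t|?L. LINT x|?N. \<rho> (x, t) * deriv (\<lambda>s. ?\<phi> (x, s)) t + m (x, t) \<bullet> grad (\<lambda>y. ?\<phi> (y, t)) x)
        + (LINT x|?N. ?\<phi> (x, 0) * \<rho>0 x) = 0"
      using cont cone_test_admissible[OF \<Omega>_bdd \<tau>] unfolding weak_continuity_eq_def by blast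
    ultimately show ?thesis
      using lhs by simp
  qed

  have "AE t in ?L. 0 \<le> (LINT x|?N. \<sigma> * G (x, t)) \<and> ((LINT x|?N. \<sigma> * G (x, t)) = 0 \<longrightarrow>
      (AE x in ?N. flat_exp 2 (\<tau> - t) * flat_exp 0 (\<sigma> * x $ 2 - 2 * t) * (1 - \<sigma> * R (x, t)) = 0))"
    using hull_t R_t w_t r_t div[unfolded weak_div_free_def]
  proof eventually_elim
    case (elim t)
    have "AE x in ?N. R (x, t) = r (x $ 2) t"
      using elim(2,4) by eventually_elim simp
    then obtain g where g: "g \<in> borel_measurable borel" "AE x in ?N. R (x, t) = g (x $ 2)"
      using AE_eq_borel_function_of_second_coordinate[OF \<Omega> slice[OF R], where r = "\<lambda>s. r s t"]
      by blast
    have flux: "(LINT x|?N. w (x, t) * k (x $ 2)) = 0"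
      if "k \<in> borel_measurable borel" "integrable ?N (\<lambda>x. w (x, t) * k (x $ 2))" for k
      using elim(3,5) wb that
      by (intro no_vertical_flux[OF \<Omega>_borel finN slice[OF w], where V = "\<lambda>x. v (x, t)" and C = "\<bar>C\<bar>"]) auto
    have h: "(\<lambda>s. flat_exp n (\<sigma> * s - 2 * t)) \<in> borel_measurable borel" for n
      by measurable
    have hb: "0 \<le> flat_exp n (\<sigma> * s - 2 * t) \<and> flat_exp n (\<sigma> * s - 2 * t) \<le> 2" if "n \<le> 2" for n s
      using that by (simp add: flat_exp_nonneg flat_exp_le)
    note dissipation = slice_dissipation[OF \<Omega>_borel finN \<sigma> slice[OF R] slice[OF w] slice[OF \<mu>] Rb wb \<mu>b
        elim(1) g flux h[of 0] h[of 2] hb[of 0] hb[of 2]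
        flat_exp_nonneg[of 2 "\<tau> - t"] flat_exp_nonneg[of 0 "\<tau> - t"], simplified]
    have "\<sigma> * G (x, t) = (1 - \<sigma> * R (x, t)) * (flat_exp 2 (\<tau> - t) * flat_exp 0 (\<sigma> * x $ 2 - 2 * t)
        + 2 * flat_exp 0 (\<tau> - t) * flat_exp 2 (\<sigma> * x $ 2 - 2 * t))
        + \<mu> (x, t) * (flat_exp 0 (\<tau> - t) * flat_exp 2 (\<sigma> * x $ 2 - 2 * t))" for x
      using \<sigma> by (auto simp: G_def cone_test_dt_def cone_test_d2_def algebra_simps)
    then show ?case
      using dissipation by simp
  qed
  then have pos: "AE t in ?L. 0 \<le> \<sigma> * (LINT x|?N. G (x, t)) \<and> ((LINT x|?N. G (x, t)) = 0 \<longrightarrow>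
      (AE x in ?N. flat_exp 2 (\<tau> - t) * flat_exp 0 (\<sigma> * x $ 2 - 2 * t) * (1 - \<sigma> * R (x, t)) = 0))"
    by simp
  have "AE t in ?L. \<sigma> * (LINT x|?N. G (x, t)) = 0"
  proof (subst integral_nonneg_eq_0_iff_AE[symmetric])
    show "AE t in ?L. 0 \<le> \<sigma> * (LINT x|?N. G (x, t))"
      using pos by eventually_elim simp
  qed (use inner_G total in auto)
  with pos R_t show ?thesis
  proof eventually_elim
    case (elim t)
    then have "AE x in ?N. flat_exp 2 (\<tau> - t) * flat_exp 0 (\<sigma> * x $ 2 - 2 * t) * (1 - \<sigma> * R (x, t)) = 0"
      using \<sigma> by auto
    with elim(2) show ?case
      by eventually_elim (use \<sigma> in \<open>auto simp: flat_exp_eq_0_iff\<close>)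
  qed
qed

theorem proposition4p3:
  fixes \<Omega> :: "(real^2) set" and T :: real and \<rho>0 :: "real^2 \<Rightarrow> real"
    and \<rho> :: "(real^2) \<times> real \<Rightarrow> real" and v m :: "(real^2) \<times> real \<Rightarrow> real^2"
    and \<U> :: "((real^2) \<times> real) set"
  assumes \<Omega>: "\<Omega> = {x. -1 < x$1 \<and> x$1 < 1 \<and> -1 < x$2 \<and> x$2 < 1}"
    and T: "T > 0"
    and \<rho>0_pos: "\<And>x. x$2 > 0 \<Longrightarrow> \<rho>0 x = 1"
    and \<rho>0_neg: "\<And>x. x$2 < 0 \<Longrightarrow> \<rho>0 x = -1"
    and subsol: "admissible_subsolution \<Omega> T \<rho>0 \<rho> v m"
    and indep: "\<exists>r. AE z in lebesgue_on (\<Omega> \<times> {0<..<T}). \<rho> z = r (fst z $ 2) (snd z)"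
    and mix: "is_mixing_zone \<Omega> T \<rho> v m \<U>"
  shows "\<U> \<subseteq> {(x, t). \<bar>x$2\<bar> < 2 * t}"
proof (rule ccontr)
  assume "\<not> ?thesis"
  then obtain x0 t0 where in\<U>: "(x0, t0) \<in> \<U>" and "\<not> \<bar>x0 $ 2\<bar> < 2 * t0"
    by auto
  then have "2 * t0 \<le> \<bar>x0 $ 2\<bar>" by simp
  moreover define \<sigma> where "\<sigma> = (if x0 $ 2 \<ge> 0 then 1 else - 1 :: real)"
  ultimately have out: "2 * t0 \<le> \<sigma> * x0 $ 2" and \<sigma>: "\<sigma> = 1 \<or> \<sigma> = -1"
    by auto
  have op: "open \<U>" and sub: "\<U> \<subseteq> \<Omega> \<times> {0<..<T}"
    and strict: "\<And>z. z \<in> \<U> \<Longrightarrow> hull_defect (\<rho> z) (v z) (m z) < (1/2) * (1 - (\<rho> z)\<^sup>2)"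
    using mix by (auto simp: is_mixing_zone_def)
  have t0: "0 < t0" "t0 < T" using in\<U> sub by auto
  \<comment> \<open>Any cut-off time strictly between \<open>t0\<close> and \<open>T\<close> serves.\<close>
  define \<tau> where "\<tau> = (t0 + T) / 2"
  have \<tau>: "t0 < \<tau>" "\<tau> < T" using t0 by (auto simp: \<tau>_def)
  obtain r where r: "AE z in lebesgue_on (\<Omega> \<times> {0<..<T}). \<rho> z = r (fst z $ 2) (snd z)"
    using indep by blast
  have "AE t in lebesgue_on {0<..<T}. AE x in lebesgue_on \<Omega>. t < \<tau> \<and> 2 * t < \<sigma> * x $ 2 \<longrightarrow> \<rho> (x, t) = \<sigma>"
  proof (rule subsolution_constant_outside_cone[OF \<Omega> T \<tau>(2) \<sigma> _ _ _ _ _ r])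
    show "\<rho>0 x = \<sigma>" if "\<sigma> * x $ 2 > 0" for x
      using that \<sigma> \<rho>0_pos[of x] \<rho>0_neg[of x] by auto
  qed (use subsol in \<open>auto simp: admissible_subsolution_def\<close>)
  moreover have "\<bar>\<rho> z\<bar> < 1" if "z \<in> \<U>" for z
  proof -
    have "0 \<le> hull_defect (\<rho> z) (v z) (m z)" by (simp add: hull_defect_def)
    then have "(\<rho> z)\<^sup>2 < 1" using strict[OF that] by (simp add: field_simps)
    then show ?thesis by (simp add: abs_square_less_1)
  qed
  ultimately have outside: "AE t in lebesgue_on {0<..<T}. AE x in lebesgue_on \<Omega>.
      t < \<tau> \<and> 2 * t < \<sigma> * x $ 2 \<longrightarrow> (x, t) \<notin> \<U>"
    using \<sigma> by (elim eventually_mono) force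

  \<comment> \<open>The point may lie on the boundary of the cone. Moving it a little away from the interface, inside the
     mixing zone, gives a product of open sets that is contained both in the mixing zone and in the outside of the cone. The height \<open>2 * c\<close> lies halfway between
     \<open>2 * t0\<close> and the height \<open>2 * t0 + \<delta>\<close> that the moved point reaches at least.\<close>
  obtain A B where AB: "open A" "open B" "x0 \<in> A" "t0 \<in> B" "A \<times> B \<subseteq> \<U>"
    using open_prod_elim[OF op in\<U>] by (metis mem_Sigma_iff)
  have "\<exists>\<delta>>0. x0 + \<delta> *\<^sub>R axis 2 \<sigma> \<in> A"
  proof -
    obtain e where e: "e > 0" "ball x0 e \<subseteq> A"
      using AB(1,3) open_contains_ball by blast
    have "norm (axis 2 \<sigma> :: real^2) = 1"
      using \<sigma> by (auto simp: norm_eq_sqrt_inner inner_axis_axis)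
    then have "x0 + (e / 2) *\<^sub>R axis 2 \<sigma> \<in> ball x0 e"
      using e by (simp add: dist_norm)
    then show ?thesis using e by (intro exI[of _ "e / 2"]) auto
  qed
  then obtain \<delta> where \<delta>: "\<delta> > 0" and inA: "x0 + \<delta> *\<^sub>R axis 2 \<sigma> \<in> A" by blast
  define c where "c = t0 + \<delta> / 4"
  define A' where "A' = A \<inter> {x. 2 * c < \<sigma> * x $ 2}"
  define B' where "B' = B \<inter> {t. t < \<tau> \<and> t < c}"
  have A': "open A'" "x0 + \<delta> *\<^sub>R axis 2 \<sigma> \<in> A'"
  proof -
    have "open {x :: real^2. 2 * c < \<sigma> * x $ 2}"
      by (intro open_Collect_less continuous_intros)
    then show "open A'" using AB by (auto simp: A'_def)
    have "\<sigma> * (x0 + \<delta> *\<^sub>R axis 2 \<sigma>) $ 2 = \<sigma> * x0 $ 2 + \<delta>"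
      using \<sigma> by (auto simp: algebra_simps)
    then show "x0 + \<delta> *\<^sub>R axis 2 \<sigma> \<in> A'" using inA out \<delta> by (auto simp: A'_def c_def)
  qed
  have B': "open B'" "t0 \<in> B'"
  proof -
    have "open {t :: real. t < \<tau> \<and> t < c}"
      by (intro open_Collect_conj open_Collect_less continuous_intros)
    then show "open B'" using AB by (auto simp: B'_def)
    show "t0 \<in> B'" using AB \<tau> \<delta> by (auto simp: B'_def c_def)
  qed
  have prod_sub: "A' \<times> B' \<subseteq> \<Omega> \<times> {0<..<T}"
    using AB sub by (auto simp: A'_def B'_def)
  have "open \<Omega>"
    unfolding \<Omega> by (intro open_Collect_conj open_Collect_less continuous_intros)
  have "AE t in lebesgue_on {0<..<T}. t \<notin> B'"
    using outside
  proof eventually_elim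
    case (elim t)
    show ?case
    proof
      assume t: "t \<in> B'"
      have "AE x in lebesgue_on \<Omega>. x \<notin> A'"
        using elim by eventually_elim (use t AB in \<open>force simp: A'_def B'_def\<close>)
      then have "A' = {}"
        using A' B' prod_sub \<open>open \<Omega>\<close> by (intro AE_notin_open_imp_empty[of A' \<Omega>]) auto
      then show False using A' by auto
    qed
  qed
  then have "B' = {}"
    using A' B' prod_sub by (intro AE_notin_open_imp_empty[of B' "{0<..<T}"]) auto
  then show False using B' by auto
qed

end
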